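(* Let $a,b,m\in\mathbb{Z}$ with $a\ge 2$, $m>1$, $\gcd(b,m)=1$, and $b\ge -(a-2)m-2$, and let $S=S_{a,b}(m)$ and $d=(a-1)m+b$. Let $n$ be the smallest positive integer such that $A_n\ge m$, let $A=\{A_1,\ldots,A_{n-1}\}$, and for $0\le\ell\le m-1$ set $W(\ell)=d\ell+\mathsf{m}_A(\ell)m$. Assume that $m=cA_{n-1}+1$ for some $c\in\{1,\dots,a\}$, and set $\alpha:=W(m-1)-m=d(m-1)+(c-1)m$. Then \[ \operatorname{Maximals}_{\preceq_S}\operatorname{Ap}(S)=\{\,W(m-1-q)\mid q=0,\ldots,n-2\,\}, \] and \[ \operatorname{PF}(S)=\{\alpha,\alpha-b,\alpha-2b,\ldots,\alpha-(n-2)b\}. \] In particular, $\operatorname{PF}(S)$ is an arithmetic progression of length $n-1$ with common difference $-b$, and $\operatorname{t}(S)=n-1$.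
   Context: $\mathbb{N}=\{0,1,2,\dots\}$. Let $T_{a,b}(z)=az+b$, with $T_{a,b}^i$ its $i$-fold composition ($T_{a,b}^0$ the identity), and let $S_{a,b}(m)=\langle T_{a,b}^i(m)\mid i\ge 0\rangle$ be the submonoid of $(\mathbb{N},+)$ generated by the orbit of $m$; under the stated hypotheses it is a numerical semigroup (finite complement in $\mathbb{N}$) whose smallest positive element is $m$. Set $A_i=(a^i-1)/(a-1)$ for $i\ge 0$ (so $A_1=1$); since $m>1$, $n\ge 2$. The Apéry set is $\operatorname{Ap}(S)=\{s\in S\mid s-m\notin S\}$; under the stated hypotheses on $a,b,m$ one has $\operatorname{Ap}(S)=\{W(0),\ldots,W(m-1)\}$. The order $\preceq_S$ is $x\preceq_S y$ iff $y-x\in S$, and $\operatorname{Maximals}_{\preceq_S}\operatorname{Ap}(S)$ is the set of maximal elements of $\operatorname{Ap}(S)$ for $\preceq_S$. $\mathsf{m}_A(x)$ is the minimum of $\sum_{i=1}^{n-1}u_i$ over all $(u_1,\ldots,u_{n-1})\in\mathbb{N}^{n-1}$ with $x=\sum_{i=1}^{n-1}u_iA_i$. A pseudo-Frobenius number of $S$ is an integer $x\notin S$ such that $x+s\in S$ for all $s\in S\setminus\{0\}$; $\operatorname{PF}(S)$ is the set of them, and the type is $\operatorname{t}(S)=|\operatorname{PF}(S)|$. *)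

theory Defs
  imports Complex_Main
begin

definition T :: "int \<Rightarrow> int \<Rightarrow> int \<Rightarrow> int"
  where "T a b z = a * z + b"

definition is_submonoid :: "int set \<Rightarrow> bool"
  where "is_submonoid M \<longleftrightarrow> 0 \<in> M \<and> (\<forall>x\<in>M. \<forall>y\<in>M. x + y \<in> M)"

(* Semigroups are kept as sets of integers, since s - m in the Apery set, y - x in the order
   and the pseudo-Frobenius numbers may be negative. The submonoid generated inside the
   integers by a set of natural numbers is the one generated inside the natural numbers. *)
definition S :: "int \<Rightarrow> int \<Rightarrow> int \<Rightarrow> int set"
  where "S a b m = is_submonoid hull (range (\<lambda>i. (T a b ^^ i) m))"

(* The division is exact for a > 1. *)
definition A :: "int \<Rightarrow> nat \<Rightarrow> int"
  where "A a i = (a ^ i - 1) div (a - 1)"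

(* Only the values u 1, ..., u (n - 1) of u matter, so that u stands for a tuple. *)
definition min_length :: "int \<Rightarrow> nat \<Rightarrow> int \<Rightarrow> nat"
  where "min_length a n x =
    (LEAST k. \<exists>u :: nat \<Rightarrow> nat. x = (\<Sum>i = 1..n - 1. int (u i) * A a i) \<and> k = (\<Sum>i = 1..n - 1. u i))"

definition W :: "int \<Rightarrow> int \<Rightarrow> int \<Rightarrow> nat \<Rightarrow> int \<Rightarrow> int"
  where "W a b m n l = ((a - 1) * m + b) * l + int (min_length a n l) * m"

definition Ap :: "int set \<Rightarrow> int \<Rightarrow> int set"
  where "Ap M m = {s \<in> M. s - m \<notin> M}"

definition preceq :: "int set \<Rightarrow> int \<Rightarrow> int \<Rightarrow> bool"
  where "preceq M x y \<longleftrightarrow> y - x \<in> M"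

definition Maximals :: "('a \<Rightarrow> 'a \<Rightarrow> bool) \<Rightarrow> 'a set \<Rightarrow> 'a set"
  where "Maximals le X = {x \<in> X. \<forall>y\<in>X. le x y \<longrightarrow> y = x}"

definition PF :: "int set \<Rightarrow> int set"
  where "PF M = {x. x \<notin> M \<and> (\<forall>s\<in>M - {0}. x + s \<in> M)}"

definition semigroup_type :: "int set \<Rightarrow> nat"
  where "semigroup_type M = card (PF M)"

(* X is the set of terms of an arithmetic progression with k distinct terms and common
   difference r. *)
definition arith_progression :: "int set \<Rightarrow> nat \<Rightarrow> int \<Rightarrow> bool"
  where "arith_progression X k r \<longleftrightarrow> (\<exists>x. bij_betw (\<lambda>q. x + int q * r) {..<k} X)"

end

theory Submission
  imports Defs
begin

text \<open>Since the orbit of \<open>m\<close> consists of the numbers \<open>m + d A\<^sub>i\<close>, the semigroup consists of the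
  \<open>d l + j m\<close> with \<open>0 \<le> l < m\<close> and \<open>j \<ge> \<mu> l\<close>, where \<open>\<mu> l\<close> is the least length of a
  representation of \<open>l\<close> by the \<open>A\<^sub>i\<close>; a carry beyond \<open>m\<close> is harmless because \<open>d \<ge> m - 2\<close>.
  Thus \<open>W l \<preceq> W l'\<close> means \<open>l \<le> l'\<close> and \<open>\<mu> l' = \<mu> l + \<mu> (l' - l)\<close>. The recursion
  \<open>A\<^sub>i\<^sub>+\<^sub>1 = a A\<^sub>i + 1\<close> makes the greedy representation a shortest one, and by induction on the number
  of available \<open>A\<^sub>i\<close> one can add some \<open>A\<^sub>i\<close> to \<open>l\<close> with \<open>\<mu>\<close> growing by exactly 1, unless
  \<open>l = m - 1 - q\<close> with \<open>q \<le> n - 2\<close>. At these exceptions \<open>\<mu>\<close> equals \<open>c + q (a - 1)\<close>, which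
  decreases as \<open>l\<close> grows, so they are the maximal elements.\<close>

section \<open>Greedy representations\<close>

text \<open>The number of coins paid out by greedy change-making with the coins
  \<open>A a 1\<close>, ..., \<open>A a k\<close>. The value at \<open>0\<close> is a default: for
  \<open>k > 0\<close> nothing is left over, as the last coin is \<open>A a 1 = 1\<close>.\<close>

primrec greedy :: "int \<Rightarrow> nat \<Rightarrow> int \<Rightarrow> int" where
  "greedy a 0 x = 0"
| "greedy a (Suc k) x = x div A a (Suc k) + greedy a k (x mod A a (Suc k))"

declare greedy.simps(2) [simp del]

section \<open>Recursion and growth of the coins\<close>

lemma A_0 [simp]: "A a 0 = 0"
  by (simp add: A_def)

context
  fixes a :: int
  assumes a: "a \<ge> 2"
begin

lemma A_Suc: "A a (Suc i) = a * A a i + 1"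
proof -
  have "A a j = (\<Sum>i<j. a ^ i)" for j
    using a by (simp add: A_def power_diff_1_eq)
  then show ?thesis
    by (simp add: sum.lessThan_Suc_shift sum_distrib_left del: sum.lessThan_Suc)
qed

lemma A_ge: "A a i \<ge> int i"
proof (induction i)
  case (Suc i)
  moreover have "a * A a i \<ge> 1 * A a i"
    using a Suc by (intro mult_right_mono) auto
  ultimately show ?case
    by (simp add: A_Suc)
qed simp

lemma A_pos: "i > 0 \<Longrightarrow> A a i > 0"
  using A_ge[of i] by simp

lemma A_mono: "i \<le> j \<Longrightarrow> A a i \<le> A a j"
proof (induction rule: dec_induct)
  case (step k)
  moreover have "a * A a k \<ge> 1 * A a k"
    using a A_ge[of k] by (intro mult_right_mono) auto
  ultimately show ?case
    by (simp add: A_Suc)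
qed simp

section \<open>Greedy count by quotient and remainder\<close>

lemma greedy_split:
  assumes "0 \<le> r" and "r < A a (Suc k)"
  shows "greedy a (Suc k) (t * A a (Suc k) + r) = t + greedy a k r"
  using assms by (simp add: greedy.simps(2))

lemma greedy_multiple: "k > 0 \<Longrightarrow> greedy a k (t * A a k) = t + greedy a (k - 1) 0"
  using A_pos[of k] by (cases k) (auto simp: greedy.simps(2))

lemma greedy_zero [simp]: "greedy a k 0 = 0"
  by (induction k) (auto simp: greedy.simps(2))

lemma greedy_small: "0 \<le> x \<Longrightarrow> x < A a (Suc k) \<Longrightarrow> greedy a (Suc k) x = greedy a k x"
  using greedy_split[of x k 0] by simp

lemma quotient_decomposition:
  assumes "x \<ge> 0"
  obtains t r where "x = t * A a (Suc k) + r" "0 \<le> t" "0 \<le> r" "r < A a (Suc k)"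
proof
  show "x = (x div A a (Suc k)) * A a (Suc k) + x mod A a (Suc k)"
    by (rule div_mult_mod_eq[symmetric])
qed (use assms A_pos[of "Suc k"] in \<open>auto simp: pos_imp_zdiv_nonneg_iff\<close>)

lemma greedy_nonneg: "x \<ge> 0 \<Longrightarrow> greedy a k x \<ge> 0"
proof (induction k arbitrary: x)
  case (Suc k)
  then show ?case
    using A_pos[of "Suc k"] by (simp add: greedy.simps(2) pos_imp_zdiv_nonneg_iff)
qed simp

section \<open>Effect of addition on the greedy count\<close>

lemma greedy_top_multiple_le: "greedy a k (a * A a k) \<le> a"
  using a greedy_multiple[of k a] by (cases k) auto

text \<open>Either only the remainder modulo the largest coin grows, or \<open>y\<close> ends in the
  largest remainder \<open>a * A a k\<close>, whose at most \<open>a\<close> coins are exchanged for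
  a single one.\<close>

lemma greedy_le_greedy_succ: "y \<ge> 0 \<Longrightarrow> greedy a k y \<le> greedy a k (y + 1) + (a - 1)"
proof (induction k arbitrary: y)
  case 0
  then show ?case using a by simp
next
  case (Suc k)
  obtain t r where y: "y = t * A a (Suc k) + r" and r: "0 \<le> r" "r < A a (Suc k)"
    using quotient_decomposition[OF Suc.prems] by metis
  show ?case
  proof (cases "r + 1 < A a (Suc k)")
    case True
    have "greedy a (Suc k) (y + 1) = t + greedy a k (r + 1)"
      using greedy_split[of "r + 1" k t] r True y by (simp add: add.assoc)
    then show ?thesis
      using greedy_split[OF r, of t] Suc.IH[OF r(1)] y by simp
  next
    case False
    then have "r = a * A a k"
      using r A_Suc[of k] by simp
    then have "greedy a (Suc k) y \<le> t + a"
      using greedy_split[OF r, of t] y greedy_top_multiple_le[of k] by simp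
    moreover have "y + 1 = (t + 1) * A a (Suc k)"
      using False r y by (simp add: algebra_simps)
    then have "greedy a (Suc k) (y + 1) = t + 1"
      using greedy_multiple[of "Suc k" "t + 1"] by simp
    ultimately show ?thesis by simp
  qed
qed

text \<open>Here \<open>a * A a k + 1\<close> is \<open>A a (Suc k)\<close>. If adding
  \<open>A a i\<close> to a remainder \<open>r\<close> carries, the new remainder is
  \<open>y = r + A a i - A a (Suc k)\<close>, and it is no dearer than \<open>r\<close>.\<close>

lemma greedy_le_greedy_carry:
  assumes "i \<in> {1..k}" and "0 \<le> y" and "y < A a i"
  shows "greedy a k y \<le> greedy a k (y + (a * A a k + 1 - A a i))"
  using assms
proof (induction k arbitrary: y)
  case (Suc k)
  let ?B = "A a (Suc k)"
  have "A a i \<le> ?B"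
    using Suc.prems by (intro A_mono) auto
  then have y: "y < ?B" "greedy a (Suc k) y = greedy a k y"
    using Suc.prems greedy_small[of y k] by auto
  have succ: "greedy a k y \<le> greedy a k (y + 1) + (a - 1)"
    using greedy_le_greedy_succ Suc.prems(2) .
  show ?case
  proof (cases "y + 1 < A a i")
    case True
    let ?r = "y + 1 + (?B - A a i)"
    \<comment> \<open>The argument equals \<open>(a - 1) * ?B + ?r\<close>; its \<open>a - 1\<close>
      coins \<open>?B\<close> make up for the loss allowed by \<open>succ\<close>.\<close>
    have "greedy a (Suc k) (y + (a * ?B + 1 - A a i)) = a - 1 + greedy a k ?r"
      using greedy_split[of ?r k "a - 1"] True \<open>A a i \<le> ?B\<close> Suc.prems(2)
      by (simp add: algebra_simps)
    moreover have "greedy a k (y + 1) \<le> greedy a k ?r"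
    proof (cases "i = Suc k")
      case False
      then show ?thesis
        using Suc.IH[of "y + 1"] True Suc.prems A_Suc[of k] by simp
    qed simp
    ultimately show ?thesis
      using succ y by simp
  next
    case False
    then have y': "y = A a i - 1"
      using Suc.prems by simp
    then have "greedy a (Suc k) (y + (a * ?B + 1 - A a i)) = a"
      using greedy_multiple[of "Suc k" a] by simp
    moreover have "greedy a j (A a i) \<le> 1" if "i \<le> j" for j
      using that
    proof (induction j rule: dec_induct)
      case base
      then show ?case using greedy_multiple[of i 1] Suc.prems by simp
    next
      case (step j)
      have "A a i \<le> A a j" "A a j < A a (Suc j)"
        using A_mono[of i j] A_Suc[of j] step a Suc.prems A_pos[of j]
          mult_right_mono[of 1 a "A a j"] by auto
      then show ?case
        using greedy_small[of "A a i" j] A_ge[of i] step by simp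
    qed
    then have "greedy a (Suc k) (A a i) \<le> 1"
      using Suc.prems by simp
    moreover have "greedy a (Suc k) y \<le> greedy a (Suc k) (A a i) + (a - 1)"
      using greedy_le_greedy_succ[OF Suc.prems(2), of "Suc k"] y' by simp
    ultimately show ?thesis by simp
  qed
qed simp

text \<open>Without a carry the claim passes to the remainder; with a carry one largest coin is
  gained and the remainder gets no dearer.\<close>

lemma greedy_add_A:
  assumes "i \<in> {1..k}" and "x \<ge> 0"
  shows "greedy a k (x + A a i) \<le> greedy a k x + 1"
  using assms
proof (induction k arbitrary: x)
  case (Suc k)
  let ?B = "A a (Suc k)"
  obtain t r where x: "x = t * ?B + r" and r: "0 \<le> r" "r < ?B"
    using quotient_decomposition[OF Suc.prems(2)] by metis
  have gx: "greedy a (Suc k) x = t + greedy a k r"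
    using greedy_split[OF r] x by simp
  show ?case
  proof (cases "i = Suc k")
    case True
    then have "x + A a i = (t + 1) * ?B + r"
      using x by (simp add: algebra_simps)
    then show ?thesis
      using greedy_split[OF r, of "t + 1"] gx by simp
  next
    case False
    then have i: "i \<in> {1..k}"
      using Suc.prems by auto
    have Ai: "0 < A a i" "A a i \<le> ?B"
      using i A_pos[of i] A_mono[of i "Suc k"] by auto
    show ?thesis
    proof (cases "r + A a i < ?B")
      case True
      then have "greedy a (Suc k) (x + A a i) = t + greedy a k (r + A a i)"
        using greedy_split[of "r + A a i" k t] r x Ai by (simp add: add.assoc)
      then show ?thesis
        using Suc.IH[OF i r(1)] gx by simp
    next
      case False
      let ?y = "r + A a i - ?B"
      have "x + A a i = (t + 1) * ?B + ?y"
        using x by (simp add: algebra_simps)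
      then have "greedy a (Suc k) (x + A a i) = t + 1 + greedy a k ?y"
        using greedy_split[of ?y k "t + 1"] False r Ai by (simp only:)
      moreover have "greedy a k ?y \<le> greedy a k r"
        using greedy_le_greedy_carry[OF i, of ?y] False r A_Suc[of k] by simp
      ultimately show ?thesis
        using gx by simp
    qed
  qed
qed simp

section \<open>The greedy count as least length\<close>

lemma greedy_add_multiple:
  assumes "i \<in> {1..k}" and "x \<ge> 0"
  shows "greedy a k (x + int v * A a i) \<le> greedy a k x + int v"
proof (induction v)
  case (Suc v)
  have "x + int v * A a i \<ge> 0"
    using assms A_ge[of i] by simp
  then show ?case
    using greedy_add_A[OF assms(1), of "x + int v * A a i"] Suc by (simp add: algebra_simps)
qed simp

text \<open>Building the sum coin by coin from 0 raises the greedy count by at most 1 each time. The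
  bound \<open>j\<close> is separate from \<open>k\<close> so that the coin system stays fixed
  during the induction.\<close>

lemma greedy_le_length:
  assumes "j \<le> k"
  shows "greedy a k (\<Sum>i = 1..j. int (u i) * A a i) \<le> int (\<Sum>i = 1..j. u i)"
  using assms
proof (induction j)
  case (Suc j)
  have "(\<Sum>i = 1..j. int (u i) * A a i) \<ge> 0"
    using A_ge by (intro sum_nonneg) (auto intro!: mult_nonneg_nonneg order_trans[OF _ A_ge])
  then show ?case
    using greedy_add_multiple[of "Suc j" k "\<Sum>i = 1..j. int (u i) * A a i" "u (Suc j)"] Suc
    by simp
qed simp

lemma greedy_representation:
  assumes "k > 0" and "x \<ge> 0"
  obtains u where "x = (\<Sum>i = 1..k. int (u i) * A a i)"
    and "greedy a k x = int (\<Sum>i = 1..k. u i)"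
proof -
  have "\<exists>u :: nat \<Rightarrow> nat. x = (\<Sum>i = 1..k. int (u i) * A a i) \<and> greedy a k x = int (\<Sum>i = 1..k. u i)"
    using assms
  proof (induction k arbitrary: x rule: nat_induct_non_zero)
    case 1
    then show ?case
      by (intro exI[of _ "\<lambda>_. nat x"]) (simp add: A_Suc greedy.simps(2))
  next
    case (Suc k)
    obtain t r where x: "x = t * A a (Suc k) + r" "0 \<le> t" and r: "0 \<le> r" "r < A a (Suc k)"
      using quotient_decomposition[OF Suc.prems] by metis
    obtain u :: "nat \<Rightarrow> nat" where u: "r = (\<Sum>i = 1..k. int (u i) * A a i)"
      "greedy a k r = int (\<Sum>i = 1..k. u i)"
      using Suc.IH[OF r(1)] by auto
    let ?u = "u(Suc k := nat t)"
    have "(\<Sum>i = 1..k. int (?u i) * A a i) = r" "(\<Sum>i = 1..k. ?u i) = (\<Sum>i = 1..k. u i)"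
      by (auto simp: u(1) intro!: sum.cong)
    moreover have "greedy a (Suc k) x = t + greedy a k r"
      using greedy_split[OF r] x by simp
    ultimately show ?case
      using x u(2) by (intro exI[of _ ?u]) simp
  qed
  then show ?thesis
    using that by blast
qed

lemma greedy_subadditive:
  assumes "k > 0" and "x \<ge> 0" and "y \<ge> 0"
  shows "greedy a k (x + y) \<le> greedy a k x + greedy a k y"
proof -
  obtain u v where u: "x = (\<Sum>i = 1..k. int (u i) * A a i)" "greedy a k x = int (\<Sum>i = 1..k. u i)"
    and v: "y = (\<Sum>i = 1..k. int (v i) * A a i)" "greedy a k y = int (\<Sum>i = 1..k. v i)"
    using greedy_representation assms by metis
  have "x + y = (\<Sum>i = 1..k. int (u i + v i) * A a i)"
    by (simp add: u v sum.distrib distrib_right)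
  then show ?thesis
    using greedy_le_length[of k k "\<lambda>i. u i + v i"] u v by (simp add: sum.distrib)
qed

lemma greedy_le_self:
  assumes "k > 0" and "x \<ge> 0"
  shows "greedy a k x \<le> x"
  using greedy_add_multiple[of 1 k 0 "nat x"] assms by (simp add: A_Suc)

lemma greedy_pos:
  assumes "k > 0" and "x > 0"
  shows "greedy a k x > 0"
proof -
  obtain u where u: "x = (\<Sum>i = 1..k. int (u i) * A a i)" "greedy a k x = int (\<Sum>i = 1..k. u i)"
    using greedy_representation[of k x] assms by auto
  show ?thesis
  proof (rule ccontr)
    assume "\<not> ?thesis"
    then have "(\<Sum>i = 1..k. u i) = 0"
      unfolding u(2) by linarith
    then have "\<forall>i\<in>{1..k}. u i = 0"
      by simp
    then have "x = 0"
      using u(1) by simp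
    then show False
      using assms by simp
  qed
qed

lemma min_length_eq_greedy:
  assumes "n \<ge> 2" and "x \<ge> 0"
  shows "int (min_length a n x) = greedy a (n - 1) x"
proof -
  obtain u where u: "x = (\<Sum>i = 1..n - 1. int (u i) * A a i)"
    "greedy a (n - 1) x = int (\<Sum>i = 1..n - 1. u i)"
    using greedy_representation[of "n - 1" x] assms by auto
  have "min_length a n x = (\<Sum>i = 1..n - 1. u i)"
    unfolding min_length_def
  proof (rule Least_equality)
    fix l
    assume "\<exists>v. x = (\<Sum>i = 1..n - 1. int (v i) * A a i) \<and> l = (\<Sum>i = 1..n - 1. v i)"
    then obtain v where "x = (\<Sum>i = 1..n - 1. int (v i) * A a i)" "l = (\<Sum>i = 1..n - 1. v i)"
      by blast
    then have "greedy a (n - 1) x \<le> int l"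
      using greedy_le_length[of "n - 1" "n - 1" v] by simp
    then show "(\<Sum>i = 1..n - 1. u i) \<le> l"
      unfolding u(2) by linarith
  qed (use u(1) in blast)
  then show ?thesis
    using u(2) by simp
qed

section \<open>Numbers just below a multiple of the largest coin\<close>

lemma greedy_below_multiple:
  assumes "q < k"
  shows "greedy a k (e * A a k - int q) = e + int q * (a - 1)"
  using assms
proof (induction k arbitrary: e q)
  case (Suc k)
  show ?case
  proof (cases q)
    case 0
    then show ?thesis
      using greedy_multiple[of "Suc k" e] by simp
  next
    case (Suc p)
    let ?r = "a * A a k - int p"
    have "1 * A a k \<le> a * A a k"
      using a A_ge[of k] by (intro mult_right_mono) auto
    then have "int p \<le> a * A a k"
      using Suc Suc.prems A_ge[of k] by linarith
    then have "0 \<le> ?r" "?r < A a (Suc k)"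
      by (auto simp: A_Suc)
    \<comment> \<open>Borrow one largest coin: as \<open>A a (Suc k) - 1 = a * A a k\<close>, the
      claim reduces to \<open>p\<close> and \<open>a\<close> in place of \<open>q\<close> and
      \<open>e\<close> one level down, at a net cost of \<open>a - 1\<close>.\<close>
    moreover have "e * A a (Suc k) - int q = (e - 1) * A a (Suc k) + ?r"
      using Suc by (simp add: A_Suc algebra_simps)
    ultimately have "greedy a (Suc k) (e * A a (Suc k) - int q) = e - 1 + greedy a k ?r"
      using greedy_split[of ?r k "e - 1"] by simp
    then show ?thesis
      using Suc.IH[of p a] Suc Suc.prems by (simp add: algebra_simps)
  qed
qed simp

text \<open>Let \<open>t\<close> be the quotient of \<open>x\<close> by the largest coin. For
  \<open>t + 2 \<le> e\<close> that coin can be added. For \<open>t = e - 1\<close> the remainder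
  lies between 0 and \<open>a\<close> times the next coin: the same problem one level down with
  \<open>a\<close> for \<open>e\<close>. For \<open>t = e\<close> only \<open>x = e * A a k\<close>
  is left.\<close>

lemma greedy_add_A_eq_or_below_multiple:
  assumes "k > 0" and "0 \<le> x" and "x \<le> e * A a k"
  shows "(\<exists>i\<in>{1..k}. x + A a i \<le> e * A a k \<and> greedy a k (x + A a i) = greedy a k x + 1)
    \<or> (\<exists>q<k. x = e * A a k - int q)"
  using assms
proof (induction k arbitrary: x e rule: nat_induct_non_zero)
  case 1
  then show ?case
    by (cases "x = e") (auto simp: A_Suc greedy.simps(2))
next
  case (Suc k)
  let ?B = "A a (Suc k)"
  obtain t r where x: "x = t * ?B + r" and r: "0 \<le> r" "r < ?B"
    using quotient_decomposition[OF Suc.prems(1)] by metis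
  have B: "?B > 0"
    using A_pos by simp
  have gx: "greedy a (Suc k) x = t + greedy a k r"
    using greedy_split[OF r] x by simp
  have "t * ?B \<le> e * ?B"
    using x r Suc.prems by linarith
  then have "t \<le> e"
    using B by simp
  then consider "t = e" | "t = e - 1" | "t + 2 \<le> e"
    by linarith
  then show ?case
  proof cases
    case 1
    then have "x = e * ?B - int 0"
      using x r Suc.prems by simp
    then show ?thesis by blast
  next
    case 2
    have "r \<le> a * A a k"
      using r by (simp add: A_Suc)
    from Suc.IH[OF r(1) this] show ?thesis
    proof (elim disjE bexE exE conjE)
      fix i
      assume i: "i \<in> {1..k}" "r + A a i \<le> a * A a k" "greedy a k (r + A a i) = greedy a k r + 1"
      then have "0 \<le> r + A a i" "r + A a i < ?B"
        using r A_ge[of i] by (auto simp: A_Suc)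
      moreover have "x + A a i = t * ?B + (r + A a i)"
        using x by simp
      ultimately have "greedy a (Suc k) (x + A a i) = greedy a (Suc k) x + 1"
        and "x + A a i \<le> e * ?B"
        using greedy_split[of "r + A a i" k t] gx i 2 by (auto simp: algebra_simps)
      then show ?thesis
        using i by (intro disjI1 bexI[of _ i]) auto
    next
      fix q
      assume "q < k" "r = a * A a k - int q"
      then have "x = e * ?B - int (Suc q)"
        using x 2 by (simp add: A_Suc algebra_simps)
      then show ?thesis
        using \<open>q < k\<close> by (intro disjI2 exI[of _ "Suc q"]) simp
    qed
  next
    case 3
    have "x + ?B = (t + 1) * ?B + r"
      using x by (simp add: algebra_simps)
    moreover have "(t + 2) * ?B \<le> e * ?B"
      using 3 B by (intro mult_right_mono) auto
    ultimately have "greedy a (Suc k) (x + ?B) = greedy a (Suc k) x + 1" and "x + ?B \<le> e * ?B"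
      using greedy_split[OF r, of "t + 1"] gx r by (auto simp: algebra_simps)
    then show ?thesis
      by (intro disjI1 bexI[of _ "Suc k"]) auto
  qed
qed

lemma T_funpow: "(T a b ^^ i) m = m + ((a - 1) * m + b) * A a i"
proof (induction i)
  case (Suc i)
  then have "(T a b ^^ Suc i) m = T a b (m + ((a - 1) * m + b) * A a i)"
    by simp
  also have "\<dots> = m + ((a - 1) * m + b) * A a (Suc i)"
    by (simp add: T_def A_Suc algebra_simps)
  finally show ?case .
qed simp

end

section \<open>Semigroups and their maximal Apery elements\<close>

text \<open>If some \<open>y\<close> in the Apery set lay strictly above \<open>x + m\<close>, then
  \<open>y - m\<close>, being \<open>x\<close> plus a nonzero element, would be in \<open>M\<close>.
  Conversely, a nonzero \<open>s\<close> with \<open>w - m + s\<close> outside \<open>M\<close>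
  would put \<open>w + s\<close> in the Apery set, strictly above \<open>w\<close>.\<close>

lemma PF_eq_Maximals_Ap:
  assumes M: "is_submonoid M" and m: "m \<in> M" "m \<noteq> 0"
  shows "PF M = (\<lambda>w. w - m) ` Maximals (preceq M) (Ap M m)"
proof (intro equalityI subsetI)
  fix x
  assume x: "x \<in> PF M"
  then have "x + m \<in> Ap M m"
    using m by (auto simp: PF_def Ap_def)
  have add: "x + s \<in> M" if "s \<in> M" "s \<noteq> 0" for s
    using x that by (auto simp: PF_def)
  have "y = x + m" if "y \<in> Ap M m" "preceq M (x + m) y" for y
  proof (rule ccontr)
    assume "y \<noteq> x + m"
    then have "x + (y - (x + m)) \<in> M"
      using that by (intro add) (auto simp: preceq_def)
    then show False
      using that by (simp add: Ap_def)
  qed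
  with \<open>x + m \<in> Ap M m\<close> have "x + m \<in> Maximals (preceq M) (Ap M m)"
    by (auto simp: Maximals_def)
  then show "x \<in> (\<lambda>w. w - m) ` Maximals (preceq M) (Ap M m)"
    by force
next
  fix x
  assume "x \<in> (\<lambda>w. w - m) ` Maximals (preceq M) (Ap M m)"
  then obtain w where w: "x = w - m" "w \<in> M" "w - m \<notin> M"
    "\<And>y. y \<in> Ap M m \<Longrightarrow> preceq M w y \<Longrightarrow> y = w"
    by (auto simp: Maximals_def Ap_def)
  have "x + s \<in> M" if s: "s \<in> M" "s \<noteq> 0" for s
  proof (rule ccontr)
    assume "x + s \<notin> M"
    then have "w + s \<in> Ap M m"
      using w(1,2) s M by (auto simp: Ap_def is_submonoid_def algebra_simps)
    then show False
      using w(4)[of "w + s"] s by (simp add: preceq_def)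
  qed
  then show "x \<in> PF M"
    using w by (auto simp: PF_def)
qed

section \<open>Semigroups given by a length function on residues\<close>

locale residue_semigroup =
  fixes d m :: int and \<mu> :: "int \<Rightarrow> int"
  assumes m: "m > 1" and d: "d \<ge> m - 2" and coprime: "coprime d m"
    and \<mu>_zero: "\<mu> 0 = 0"
    and \<mu>_subadditive: "0 \<le> x \<Longrightarrow> 0 \<le> y \<Longrightarrow> \<mu> (x + y) \<le> \<mu> x + \<mu> y"
    and \<mu>_le: "0 \<le> x \<Longrightarrow> \<mu> x \<le> x"
    and \<mu>_pos: "0 < x \<Longrightarrow> 0 < \<mu> x"
begin

text \<open>A normal form: \<open>l\<close> fixes the class modulo \<open>m\<close>, and within it
  the elements start at \<open>j = \<mu> l\<close>. In the application \<open>\<mu>\<close> is the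
  greedy count, \<open>R\<close> is \<open>S a b m\<close> and \<open>w\<close> is
  \<open>W\<close>.\<close>

definition R :: "int set"
  where "R = {d * l + j * m | l j. 0 \<le> l \<and> l < m \<and> \<mu> l \<le> j}"

definition w :: "int \<Rightarrow> int"
  where "w l = d * l + \<mu> l * m"

text \<open>The bound on \<open>d\<close> admits \<open>d = 0\<close> only for \<open>m = 2\<close>,
  where coprimality excludes it.\<close>

lemma d_pos: "d > 0"
proof (rule ccontr)
  assume "\<not> d > 0"
  then have "d = 0"
    using d m by linarith
  then show False
    using coprime m by simp
qed

text \<open>Reducing \<open>x\<close> modulo \<open>m\<close> turns \<open>d * x\<close> into
  \<open>d * (x mod m)\<close> and at least \<open>d\<close> copies of \<open>m\<close>. With
  \<open>j \<ge> 1\<close> and \<open>d \<ge> m - 2\<close> this makes at least \<open>m - 1\<close>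
  copies, while \<open>\<mu>\<close> is at most \<open>m - 1\<close> on residues.\<close>

lemma \<mu>_le_carry:
  assumes "x \<ge> m" and "j \<ge> 1"
  shows "\<mu> (x mod m) \<le> j + d * (x div m)"
proof -
  have "x div m \<ge> 1"
    using assms m by (metis div_self less_le_not_le not_one_le_zero order_trans zdiv_mono1 zero_less_one)
  then have "d \<le> d * (x div m)"
    using d_pos mult_left_mono[of 1 "x div m" d] by simp
  moreover have "\<mu> (x mod m) \<le> m - 1"
    using \<mu>_le[of "x mod m"] m pos_mod_bound[of m x] pos_mod_sign[of m x] by linarith
  ultimately show ?thesis
    using assms d by linarith
qed

text \<open>Unreduced \<open>x\<close> are allowed: for \<open>x \<ge> m\<close> positivity of
  \<open>\<mu>\<close> forces \<open>j \<ge> 1\<close>, and the carry does the rest.\<close>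

lemma R_memI:
  assumes "x \<ge> 0" and "\<mu> x \<le> j"
  shows "d * x + j * m \<in> R"
proof (cases "x < m")
  case True
  then show ?thesis
    using assms by (auto simp: R_def)
next
  case False
  then have "j \<ge> 1"
    using assms m \<mu>_pos[of x] by linarith
  then have "\<mu> (x mod m) \<le> j + d * (x div m)"
    using \<mu>_le_carry False by simp
  moreover have "d * x + j * m = d * (x mod m) + (j + d * (x div m)) * m"
    by (subst mult_div_mod_eq[of m x, symmetric]) (simp only: algebra_simps)
  ultimately show ?thesis
    using m unfolding R_def by fastforce
qed

text \<open>From \<open>m\<close> on a single copy of \<open>m\<close> suffices, however large
  \<open>\<mu> x\<close> is; this covers the orbit elements with
  \<open>A a i \<ge> m\<close>.\<close>

lemma R_carry:
  assumes "x \<ge> m" and "j \<ge> 1"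
  shows "d * x + j * m \<in> R"
proof -
  have "d * (x mod m) + (j + d * (x div m)) * m \<in> R"
    using \<mu>_le_carry[OF assms] m by (intro R_memI) auto
  moreover have "d * x + j * m = d * (x mod m) + (j + d * (x div m)) * m"
    by (subst mult_div_mod_eq[of m x, symmetric]) (simp only: algebra_simps)
  ultimately show ?thesis by simp
qed

lemma residue_unique:
  assumes "d * l + j * m = d * l' + j' * m"
    and "0 \<le> l" "l < m" "0 \<le> l'" "l' < m"
  shows "l = l' \<and> j = j'"
proof -
  have "d * (l - l') = (j' - j) * m"
    using assms(1) by (simp add: algebra_simps)
  then have "m dvd l - l'"
    using coprime by (metis coprime_commute coprime_dvd_mult_right_iff dvd_triv_right)
  then have "l = l'"
    using assms(2-) zdvd_imp_le[of m "l - l'"] zdvd_imp_le[of m "l' - l"]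
    by (cases l l' rule: linorder_cases) (auto simp: dvd_diff_commute)
  then show ?thesis
    using assms(1) m by simp
qed

lemma R_mem_iff:
  assumes "0 \<le> l" and "l < m"
  shows "d * l + j * m \<in> R \<longleftrightarrow> \<mu> l \<le> j"
  using residue_unique[of l j] assms by (auto simp: R_def)

lemma R_submonoid: "is_submonoid R"
  unfolding is_submonoid_def
proof (intro conjI ballI)
  show "0 \<in> R"
    using R_memI[of 0 0] \<mu>_zero by simp
next
  fix x y
  assume "x \<in> R" "y \<in> R"
  then obtain l j l' j' where x: "x = d * l + j * m" "0 \<le> l" "\<mu> l \<le> j"
    and y: "y = d * l' + j' * m" "0 \<le> l'" "\<mu> l' \<le> j'"
    unfolding R_def by blast
  have "d * (l + l') + (j + j') * m \<in> R"
    using x y \<mu>_subadditive[of l l'] by (intro R_memI) linarith+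
  then show "x + y \<in> R"
    using x y by (simp add: algebra_simps)
qed

lemma m_mem_R: "m \<in> R"
  using R_memI[of 0 1] \<mu>_zero by simp

lemma Ap_R: "Ap R m = w ` {0..<m}"
proof (intro equalityI subsetI)
  fix x
  assume "x \<in> Ap R m"
  then obtain l j where x: "x = d * l + j * m" "0 \<le> l" "l < m" "\<mu> l \<le> j" "x - m \<notin> R"
    unfolding Ap_def R_def by blast
  have "x - m = d * l + (j - 1) * m"
    using x(1) by (simp add: algebra_simps)
  then have "d * l + (j - 1) * m \<notin> R"
    using x(5) by simp
  then have "j = \<mu> l"
    using x(2-4) R_mem_iff[of l "j - 1"] by simp
  then show "x \<in> w ` {0..<m}"
    using x by (auto simp: w_def)
next
  fix x
  assume "x \<in> w ` {0..<m}"
  then obtain l where x: "x = d * l + \<mu> l * m" "0 \<le> l" "l < m"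
    by (auto simp: w_def)
  have "x - m = d * l + (\<mu> l - 1) * m"
    using x(1) by (simp add: algebra_simps)
  then have "x - m \<notin> R"
    using x(2,3) R_mem_iff[of l "\<mu> l - 1"] by simp
  then show "x \<in> Ap R m"
    using x R_mem_iff[of l "\<mu> l"] by (simp add: Ap_def)
qed

text \<open>For \<open>l \<le> l'\<close>, membership of the difference gives one inequality between
  the lengths and subadditivity the other. For \<open>l > l'\<close> the difference never lies in
  \<open>R\<close>.\<close>

lemma preceq_w_iff:
  assumes "0 \<le> l" "l < m" "0 \<le> l'" "l' < m"
  shows "preceq R (w l) (w l') \<longleftrightarrow> l \<le> l' \<and> \<mu> l' = \<mu> l + \<mu> (l' - l)"
proof (cases "l \<le> l'")
  case True
  have "w l' - w l = d * (l' - l) + (\<mu> l' - \<mu> l) * m"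
    by (simp add: w_def algebra_simps)
  then show ?thesis
    using R_mem_iff[of "l' - l" "\<mu> l' - \<mu> l"] \<mu>_subadditive[of l "l' - l"] assms True
    by (auto simp: preceq_def)
next
  case False
  \<comment> \<open>Adding \<open>m\<close> reduces the negative residue and costs \<open>d\<close>
    copies of \<open>m\<close>. The number of copies left is at most
    \<open>(m - 2) - 1 - (m - 2) < 0\<close>, whereas \<open>\<mu>\<close> of the residue is
    positive.\<close>
  have "w l' - w l = d * (l' - l + m) + (\<mu> l' - \<mu> l - d) * m"
    by (simp add: w_def algebra_simps)
  moreover have "\<mu> l' \<le> m - 2" "\<mu> l > 0" "\<mu> (l' - l + m) > 0"
    using \<mu>_le[of l'] \<mu>_pos[of l] \<mu>_pos[of "l' - l + m"] assms False by auto
  ultimately show ?thesis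
    using R_mem_iff[of "l' - l + m" "\<mu> l' - \<mu> l - d"] assms False d by (simp add: preceq_def)
qed

lemma w_inj:
  assumes "w l = w l'" "0 \<le> l" "l < m" "0 \<le> l'" "l' < m"
  shows "l = l'"
  using residue_unique[of l "\<mu> l" l' "\<mu> l'"] assms by (simp add: w_def)

lemma Maximals_Ap_R:
  "Maximals (preceq R) (Ap R m) =
    w ` {l \<in> {0..<m}. \<forall>l'\<in>{l<..<m}. \<mu> l' \<noteq> \<mu> l + \<mu> (l' - l)}" (is "_ = w ` ?X")
proof -
  have "w l \<in> Maximals (preceq R) (w ` {0..<m}) \<longleftrightarrow> l \<in> ?X" if l: "l \<in> {0..<m}" for l
  proof -
    have interval: "l' \<in> {l<..<m} \<longleftrightarrow> l' \<in> {0..<m} \<and> l \<le> l' \<and> l' \<noteq> l" for l'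
      using l by auto
    have "w l \<in> Maximals (preceq R) (w ` {0..<m})
        \<longleftrightarrow> (\<forall>l'\<in>{0..<m}. preceq R (w l) (w l') \<longrightarrow> l' = l)"
      using l w_inj by (auto simp: Maximals_def)
    also have "\<dots> \<longleftrightarrow> (\<forall>l'\<in>{0..<m}. l \<le> l' \<and> \<mu> l' = \<mu> l + \<mu> (l' - l) \<longrightarrow> l' = l)"
      using l preceq_w_iff by (intro ball_cong refl) auto
    also have "\<dots> \<longleftrightarrow> l \<in> ?X"
      unfolding mem_Collect_eq Ball_def interval using l by blast
    finally show ?thesis .
  qed
  moreover have "Maximals (preceq R) (w ` {0..<m}) \<subseteq> w ` {0..<m}"
    by (auto simp: Maximals_def)
  ultimately show ?thesis
    unfolding Ap_R by blast
qed

end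

section \<open>The generated semigroup in normal form\<close>

lemma submonoid_scale:
  assumes "is_submonoid M" and "x \<in> M"
  shows "int v * x \<in> M"
  using assms by (induction v) (auto simp: is_submonoid_def algebra_simps)

lemma submonoid_sum:
  assumes "is_submonoid M" and "\<And>i. i \<in> I \<Longrightarrow> f i \<in> M"
  shows "sum f I \<in> M"
  using assms by (induction I rule: infinite_finite_induct) (auto simp: is_submonoid_def)

lemma is_submonoid_S: "is_submonoid (S a b m)"
  unfolding S_def by (rule hull_in) (auto simp: is_submonoid_def)

text \<open>The bounds on \<open>m\<close> split the orbit: \<open>A a i\<close> has greedy count at
  most 1 for \<open>i \<le> k\<close>, and \<open>A a i \<ge> m\<close> for \<open>i > k\<close>.
  Conversely, the greedy representation of \<open>l\<close> writes \<open>d * l + j * m\<close> as a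
  sum of orbit elements.\<close>

lemma S_eq_R:
  fixes a b m d :: int and k :: nat
  assumes a: "a \<ge> 2" and k: "k > 0" and m_bounds: "A a k < m" "m \<le> A a (Suc k)"
    and d_eq: "d = (a - 1) * m + b"
    and R: "residue_semigroup d m (greedy a k)"
  shows "S a b m = residue_semigroup.R d m (greedy a k)"
proof -
  interpret residue_semigroup d m "greedy a k"
    by (rule R)
  have "(T a b ^^ i) m \<in> S a b m" for i
    unfolding S_def by (rule hull_inc) simp
  then have gen: "m + d * A a i \<in> S a b m" for i
    by (simp only: T_funpow[OF a] d_eq)
  have "range (\<lambda>i. (T a b ^^ i) m) \<subseteq> R"
  proof (rule image_subsetI)
    fix i
    have "d * A a i + 1 * m \<in> R"
    proof (cases "i \<le> k")
      case True
      then have "greedy a k (A a i) \<le> 1"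
        using greedy_add_A[OF a, of i k 0] greedy_zero[OF a] by (cases "i = 0") auto
      then show ?thesis
        using A_ge[OF a, of i] by (intro R_memI) auto
    next
      case False
      then show ?thesis
        using A_mono[OF a, of "Suc k" i] m_bounds by (intro R_carry) auto
    qed
    then show "(T a b ^^ i) m \<in> R"
      by (simp add: T_funpow[OF a] d_eq algebra_simps)
  qed
  then have "S a b m \<subseteq> R"
    unfolding S_def using R_submonoid by (rule hull_minimal)
  moreover have "R \<subseteq> S a b m"
  proof
    fix x
    assume "x \<in> R"
    then obtain l j where x: "x = d * l + j * m" "0 \<le> l" "greedy a k l \<le> j"
      unfolding R_def by blast
    obtain u where u: "l = (\<Sum>i = 1..k. int (u i) * A a i)" "greedy a k l = int (\<Sum>i = 1..k. u i)"
      using greedy_representation[OF a k x(2)] by metis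
    have "(\<Sum>i = 1..k. int (u i) * (m + d * A a i)) \<in> S a b m"
      using gen by (intro submonoid_sum submonoid_scale is_submonoid_S)
    \<comment> \<open>The surplus over the greedy count consists of copies of \<open>m\<close>, the
      generator belonging to \<open>A a 0 = 0\<close>.\<close>
    moreover have "int (nat (j - greedy a k l)) * m \<in> S a b m"
      using gen[of 0] by (intro submonoid_scale is_submonoid_S) simp
    ultimately have "(\<Sum>i = 1..k. int (u i) * (m + d * A a i)) + (j - greedy a k l) * m \<in> S a b m"
      using is_submonoid_S[of a b m] x by (auto simp: is_submonoid_def)
    moreover have "(\<Sum>i = 1..k. int (u i) * (m + d * A a i)) = d * l + greedy a k l * m"
      unfolding u(2) unfolding u(1) by (simp add: sum.distrib sum_distrib_left sum_distrib_right algebra_simps)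
    ultimately show "x \<in> S a b m"
      using x(1) by (simp add: algebra_simps)
  qed
  ultimately show ?thesis by blast
qed

text \<open>Away from the top a coin can be added at cost 1. At the exceptions every larger residue
  is \<open>c * A a k - int p\<close> with \<open>p < q\<close>, where the greedy count is strictly
  smaller, so equality is impossible.\<close>

lemma non_extendable_residues:
  fixes a c :: int and k :: nat
  assumes a: "a \<ge> 2" and k: "k > 0" and c: "c \<ge> 1"
  shows "{l \<in> {0..<c * A a k + 1}. \<forall>l'\<in>{l<..<c * A a k + 1}.
      greedy a k l' \<noteq> greedy a k l + greedy a k (l' - l)}
    = (\<lambda>q. c * A a k - int q) ` {..<k}" (is "?X = _")
proof (intro equalityI subsetI)
  fix l
  assume l: "l \<in> ?X"
  have "\<not> (l + A a i \<le> c * A a k \<and> greedy a k (l + A a i) = greedy a k l + 1)" if "i \<in> {1..k}" for i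
  proof
    assume i: "l + A a i \<le> c * A a k \<and> greedy a k (l + A a i) = greedy a k l + 1"
    have "A a i > 0"
      using A_pos[OF a] that by simp
    \<comment> \<open>At most 1 by adding the coin to 0, at least 1 by positivity. So
      \<open>l' = l + A a i\<close> contradicts the choice of \<open>l\<close>.\<close>
    then have "greedy a k (A a i) = 1"
      using greedy_add_A[OF a that, of 0] greedy_zero[OF a] greedy_pos[OF a k, of "A a i"] by simp
    then show False
      using l i \<open>A a i > 0\<close> by force
  qed
  then show "l \<in> (\<lambda>q. c * A a k - int q) ` {..<k}"
    using greedy_add_A_eq_or_below_multiple[OF a k, of l c] l by auto
next
  fix l
  assume "l \<in> (\<lambda>q. c * A a k - int q) ` {..<k}"
  then obtain q where q: "q < k" "l = c * A a k - int q"
    by auto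
  have "1 * A a k \<le> c * A a k"
    using c A_ge[OF a, of k] by (intro mult_right_mono) auto
  then have "int q \<le> c * A a k"
    using q A_ge[OF a, of k] by linarith
  moreover have "greedy a k l' \<noteq> greedy a k l + greedy a k (l' - l)"
    if l': "l' \<in> {l<..<c * A a k + 1}" for l'
  proof -
    define p where "p = nat (c * A a k - l')"
    have p: "p < q" "l' = c * A a k - int p"
      using l' q by (auto simp: p_def)
    have "int p * (a - 1) < int q * (a - 1)"
      using p a by (intro mult_strict_right_mono) auto
    then have "greedy a k l' < greedy a k l"
      using greedy_below_multiple[OF a, of _ k c] p q by simp
    then show ?thesis
      using greedy_nonneg[OF a, of "l' - l" k] l' by simp
  qed
  ultimately show "l \<in> ?X"
    using q by auto
qed

section \<open>Maximal elements and pseudo-Frobenius numbers when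
  \<open>m = c * A a (n - 1) + 1\<close>\<close>

theorem theorem8p1:
  fixes a b m c d \<alpha> :: int and n :: nat
  assumes "a \<ge> 2" and "m > 1" and "gcd b m = 1" and "b \<ge> - (a - 2) * m - 2"
    and "d = (a - 1) * m + b"
    and "n = (LEAST k. k > 0 \<and> A a k \<ge> m)"
    and "c \<in> {1..a}" and "m = c * A a (n - 1) + 1"
    and "\<alpha> = W a b m n (m - 1) - m"
  shows "\<alpha> = d * (m - 1) + (c - 1) * m
    \<and> Maximals (preceq (S a b m)) (Ap (S a b m) m) = {W a b m n (m - 1 - int q) | q. q \<in> {0..n - 2}}
    \<and> PF (S a b m) = {\<alpha> - int q * b | q. q \<in> {0..n - 2}}
    \<and> arith_progression (PF (S a b m)) (n - 1) (- b)
    \<and> semigroup_type (S a b m) = n - 1"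
proof -
  note a = assms(1)
  define k where "k = n - 1"
  have m_eq: "m = c * A a k + 1"
    using assms(8) by (simp add: k_def)
  \<comment> \<open>Since \<open>A a 0 = 0\<close>, the case \<open>k = 0\<close> would give
    \<open>m = 1\<close>.\<close>
  have k: "k > 0"
    using m_eq assms(2) by (cases k) auto
  then have n: "n \<ge> 2" and n_range: "{0..n - 2} = {..<k}"
    by (auto simp: k_def)
  have A_k: "A a k > 0"
    using A_pos[OF a k] .
  \<comment> \<open>By \<open>1 \<le> c \<le> a\<close>, the modulus lies between
    \<open>A a k\<close> and \<open>A a (Suc k) = a * A a k + 1\<close>.\<close>
  have "1 * A a k \<le> c * A a k" "c * A a k \<le> a * A a k"
    using A_k assms(7) by (intro mult_right_mono; simp)+
  then have m_bounds: "A a k < m" "m \<le> A a (Suc k)"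
    by (auto simp: m_eq A_Suc[OF a])
  have "coprime d m"
    using assms(3,5) by (simp add: coprime_iff_gcd_eq_1 gcd.commute gcd_add_mult)
  moreover have "d \<ge> m - 2"
    using assms(4,5) by (simp add: algebra_simps)
  ultimately interpret residue_semigroup d m "greedy a k"
    using assms(2) greedy_zero[OF a] greedy_subadditive[OF a k] greedy_le_self[OF a k]
      greedy_pos[OF a k]
    by unfold_locales auto
  have S: "S a b m = R"
    using S_eq_R[OF a k m_bounds assms(5)] residue_semigroup_axioms by blast
  have W: "W a b m n l = w l" if "l \<ge> 0" for l
    using min_length_eq_greedy[OF a n that, folded k_def]
    by (simp add: W_def w_def assms(5)[symmetric])
  have "m - 1 - int q \<ge> 0" if "q < k" for q
    using that m_bounds(1) A_ge[OF a, of k] by linarith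
  then have w: "w (m - 1 - int q) = W a b m n (m - 1 - int q)" if "q < k" for q
    using W that by simp
  \<comment> \<open>Each step down loses \<open>d\<close> and gains \<open>(a - 1) * m\<close>, a
    net change of \<open>- b\<close>.\<close>
  have w_eq: "w (m - 1 - int q) = d * (m - 1) + c * m - int q * b" if "q < k" for q
  proof -
    have "greedy a k (m - 1 - int q) = c + int q * (a - 1)"
      using greedy_below_multiple[OF a that, of c] by (simp add: m_eq)
    then have "w (m - 1 - int q) = d * (m - 1 - int q) + (c + int q * (a - 1)) * m"
      by (simp only: w_def)
    then show ?thesis
      by (simp add: assms(5) algebra_simps)
  qed
  have \<alpha>: "\<alpha> = d * (m - 1) + (c - 1) * m"
    using w_eq[of 0] w[of 0] k assms(9) by (simp add: algebra_simps)
  have max: "Maximals (preceq R) (Ap R m) = (\<lambda>q. w (m - 1 - int q)) ` {..<k}"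
    using non_extendable_residues[OF a k, of c] assms(7)
    unfolding Maximals_Ap_R by (simp add: m_eq image_image)
  have PF: "PF R = (\<lambda>q. \<alpha> - int q * b) ` {..<k}"
  proof -
    have "PF R = (\<lambda>q. w (m - 1 - int q) - m) ` {..<k}"
      using PF_eq_Maximals_Ap[OF R_submonoid m_mem_R] assms(2) by (simp add: max image_image)
    also have "\<dots> = (\<lambda>q. \<alpha> - int q * b) ` {..<k}"
      by (rule image_cong[OF refl], subst w_eq) (auto simp: \<alpha> algebra_simps)
    finally show ?thesis .
  qed
  \<comment> \<open>Otherwise \<open>gcd b m = m > 1\<close>. Hence the terms of the progression are
    distinct.\<close>
  have "b \<noteq> 0"
    using assms(2,3) by auto
  then have inj: "inj_on (\<lambda>q. \<alpha> - int q * b) {..<k}"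
    by (auto intro: inj_onI)
  then have "arith_progression (PF R) k (- b)"
    unfolding arith_progression_def by (intro exI[of _ \<alpha>]) (simp add: bij_betw_def PF)
  moreover have "semigroup_type R = k"
    using inj by (simp add: semigroup_type_def PF card_image)
  moreover have "(\<lambda>q. w (m - 1 - int q)) ` {..<k} = {W a b m n (m - 1 - int q) | q. q \<in> {..<k}}"
    using w by (auto simp: image_def)
  moreover have "PF R = {\<alpha> - int q * b | q. q \<in> {..<k}}"
    unfolding PF by blast
  ultimately show ?thesis
    unfolding S n_range using \<alpha> max by (simp add: k_def)
qed

end
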